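(* Let $n$ be a positive integer. Assume that (the image of) $B_{\mathfrak{B}_n}^{(1,2)}$ is a $\mathbb{C}$-vector space basis of $R_{\mathfrak{B}_n}^{(1,2)}$. Then the Hilbert series of $R_{\mathfrak{B}_n}^{(1,2)}$ is $$\sum_{\pi\in\Pi(n)_{\ge0}}u^{\deg_\theta(\pi)}\,v^{\deg_\xi(\pi)}\,\mathrm{stair}_q^B(\pi).$$
   Context: **The ring.** Let $\mathbb{C}[\boldsymbol{x}_n,\boldsymbol\theta_n,\boldsymbol\xi_n]$ be the algebra generated by commuting variables $x_1,\ldots,x_n$ (commuting with all variables) and variables $\theta_1,\ldots,\theta_n,\xi_1,\ldots,\xi_n$ which all anticommute with one another (so square to zero). The Weyl group $\mathfrak{B}_n$ of type $B_n$ (signed permutations) acts diagonally, by permuting the indices with sign, the same signed permutation acting on each of the three sets of variables. $R_{\mathfrak{B}_n}^{(1,2)}$ is the quotient by the ideal generated by all $\mathfrak{B}_n$-invariant elements with zero constant term. It is graded by $x$-, $\theta$- and $\xi$-degree; its Hilbert series is $\sum_{a,b,c}\dim\big((R_{\mathfrak{B}_n}^{(1,2)})_{a,b,c}\big)q^au^bv^c$, where the indexed component has $x$-degree $a$, $\theta$-degree $b$, $\xi$-degree $c$. **Paths and $B_{\mathfrak{B}_n}^{(1,2)}$.** $\Pi(n)_{\ge0}$ is the set of lattice paths $\pi=(p_1,\ldots,p_n)$ in $\mathbb{Z}^2$ starting at $(0,0)$ whose $i$-th step $p_i$ is one of: an (undecorated) up-step $(1,1)$; a horizontal step $(1,0)$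 with decoration $\theta_i$; a horizontal step $(1,0)$ with decoration $\xi_i$; a down-step $(1,-1)$ with decoration $\theta_i\xi_i$; such that the path never goes below the line $y=0$. Let $T(\pi)$ (resp. $S(\pi)$) be the set of indices $i\in\{1,\ldots,n\}$ such that $\theta_i$ (resp. $\xi_i$) occurs in the decoration of $p_i$; $\deg_\theta(\pi)=|T(\pi)|$, $\deg_\xi(\pi)=|S(\pi)|$. For $T,S\subseteq\{1,\ldots,n\}$ define $\beta(T,S)$ by $\beta_1(T,S)=-1+\chi(1\notin T)+\chi(1\notin S)$ and, for $2\le i\le n$, $\beta_i(T,S)=\beta_{i-1}(T,S)-2+\chi(i\notin T)+\chi(i-1\notin T)+\chi(i\notin S)+\chi(i-1\notin S)$, where $\chi(P)=1$ if $P$ is true and $0$ otherwise. $B_{\mathfrak{B}_n}^{(1,2)}$ is the set of monomials $x^\beta\theta_T\xi_S$ ($\theta_T,\xi_S$ the products in increasing order of indices; signs irrelevant) such that $(T,S)=(T(\pi),S(\pi))$ for some $\pi\in\Pi(n)_{\ge0}$ and $0\le\beta_i\le\beta_i(T,S)$ for all $i$. With $[m]_q=1+q+\cdots+q^{m-1}$, $\mathrm{stair}^B_q(\pi)=\prod_{i=1}^n[\beta_i(T(\pi),S(\pi))+1]_q$. *)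

theory Defs
  imports
    "HOL-Algebra.QuotRing"
    "HOL-Library.Poly_Mapping"
    "HOL-Library.Product_Plus"
    "HOL-Computational_Algebra.Formal_Power_Series"
    "Jordan_Normal_Form.VS_Connect"
begin

hide_const (open) Multiset.mult Polynomial.smult

section \<open>The algebra with one set of commuting and two sets of anticommuting variables\<close>

text \<open>The triple \<open>(\<alpha>, T, S)\<close> stands for the monomial \<open>x\<^sup>\<alpha> \<theta>\<^sub>T \<xi>\<^sub>S\<close>, where the products \<open>\<theta>\<^sub>T\<close> and \<open>\<xi>\<^sub>S\<close>
  are taken in increasing order of the indices.\<close>

type_synonym smonom = "(nat \<Rightarrow>\<^sub>0 nat) \<times> nat set \<times> nat set"
type_synonym spoly = "smonom \<Rightarrow>\<^sub>0 complex"

definition smonoms :: "nat \<Rightarrow> smonom set" where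
  "smonoms n = {(\<alpha>, T, S). Poly_Mapping.keys \<alpha> \<subseteq> {1..n} \<and> T \<subseteq> {1..n} \<and> S \<subseteq> {1..n}}"

definition crossings :: "nat set \<Rightarrow> nat set \<Rightarrow> nat" where
  "crossings A B = card {(a, b). a \<in> A \<and> b \<in> B \<and> b < a}"

text \<open>The product of two monomials is \<open>smonom_sign\<close> times \<open>smonom_join\<close>.  It vanishes if an
  anticommuting variable occurs in both factors.  Otherwise the sign is that of the sorting
  \<open>\<theta>\<^sub>T \<xi>\<^sub>S \<theta>\<^sub>T\<^sub>' \<xi>\<^sub>S\<^sub>' = \<plusminus> \<theta>\<^sub>T\<^sub>\<union>\<^sub>T\<^sub>' \<xi>\<^sub>S\<^sub>\<union>\<^sub>S\<^sub>'\<close>: moving \<open>\<theta>\<^sub>T\<^sub>'\<close> past \<open>\<xi>\<^sub>S\<close> takes \<open>card S * card T'\<close> transpositions,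
  and merging two increasing products takes one transposition for each crossing.\<close>

fun smonom_join :: "smonom \<Rightarrow> smonom \<Rightarrow> smonom" where
  "smonom_join (\<alpha>, T, S) (\<beta>, T', S') = (\<alpha> + \<beta>, T \<union> T', S \<union> S')"

fun smonom_sign :: "smonom \<Rightarrow> smonom \<Rightarrow> complex" where
  "smonom_sign (\<alpha>, T, S) (\<beta>, T', S') =
     (if T \<inter> T' = {} \<and> S \<inter> S' = {}
      then (-1) ^ (card S * card T' + crossings T T' + crossings S S') else 0)"

definition spoly_mult :: "spoly \<Rightarrow> spoly \<Rightarrow> spoly" where
  "spoly_mult p q =
     (\<Sum>m \<in> Poly_Mapping.keys p. \<Sum>m' \<in> Poly_Mapping.keys q.
        Poly_Mapping.single (smonom_join m m')
          (smonom_sign m m' * Poly_Mapping.lookup p m * Poly_Mapping.lookup q m'))"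

definition spoly_const :: "complex \<Rightarrow> spoly" where
  "spoly_const c = Poly_Mapping.single (0, {}, {}) c"

definition spoly_ring :: "nat \<Rightarrow> spoly ring" where
  "spoly_ring n =
     \<lparr>carrier = {p. Poly_Mapping.keys p \<subseteq> smonoms n}, mult = spoly_mult, one = spoly_const 1,
      zero = 0, add = (+)\<rparr>"

definition x_var :: "nat \<Rightarrow> spoly" where
  "x_var i = Poly_Mapping.single (Poly_Mapping.single i 1, {}, {}) 1"

definition theta_var :: "nat \<Rightarrow> spoly" where
  "theta_var i = Poly_Mapping.single (0, {i}, {}) 1"

definition xi_var :: "nat \<Rightarrow> spoly" where
  "xi_var i = Poly_Mapping.single (0, {}, {i}) 1"


section \<open>The action of the signed permutations and the quotient\<close>

definition signed_perms :: "nat \<Rightarrow> (int \<Rightarrow> int) set" where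
  "signed_perms n = {w. w permutes ({- int n..int n} - {0}) \<and> (\<forall>i. w (- i) = - w i)}"

text \<open>A signed permutation \<open>w\<close> sends the variable with index \<open>i\<close> to the one with index \<open>\<bar>w i\<bar>\<close>,
  multiplied by the sign of \<open>w i\<close>.\<close>

definition act_var :: "nat \<Rightarrow> (int \<Rightarrow> int) \<Rightarrow> (nat \<Rightarrow> spoly) \<Rightarrow> nat \<Rightarrow> spoly" where
  "act_var n w z i =
     spoly_const (of_int (sgn (w (int i)))) \<otimes>\<^bsub>spoly_ring n\<^esub> z (nat \<bar>w (int i)\<bar>)"

definition ordered_prod :: "('a, 'b) monoid_scheme \<Rightarrow> 'a list \<Rightarrow> 'a" where
  "ordered_prod R ps = foldr (mult R) ps (one R)"

fun act_smonom :: "nat \<Rightarrow> (int \<Rightarrow> int) \<Rightarrow> smonom \<Rightarrow> spoly" where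
  "act_smonom n w (\<alpha>, T, S) =
     (ordered_prod (spoly_ring n)
        (map (\<lambda>i. act_var n w x_var i [^]\<^bsub>spoly_ring n\<^esub> Poly_Mapping.lookup \<alpha> i) [1..<n + 1])
      \<otimes>\<^bsub>spoly_ring n\<^esub>
      ordered_prod (spoly_ring n) (map (act_var n w theta_var) (sorted_list_of_set T)))
      \<otimes>\<^bsub>spoly_ring n\<^esub>
      ordered_prod (spoly_ring n) (map (act_var n w xi_var) (sorted_list_of_set S))"

definition act_spoly :: "nat \<Rightarrow> (int \<Rightarrow> int) \<Rightarrow> spoly \<Rightarrow> spoly" where
  "act_spoly n w p =
     (\<Sum>m \<in> Poly_Mapping.keys p.
        spoly_const (Poly_Mapping.lookup p m) \<otimes>\<^bsub>spoly_ring n\<^esub> act_smonom n w m)"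

definition coinv_ideal :: "nat \<Rightarrow> spoly set" where
  "coinv_ideal n = Idl\<^bsub>spoly_ring n\<^esub>
     {f \<in> carrier (spoly_ring n).
        (\<forall>w \<in> signed_perms n. act_spoly n w f = f) \<and> Poly_Mapping.lookup f (0, {}, {}) = 0}"

definition coinv_class :: "nat \<Rightarrow> spoly \<Rightarrow> spoly set" where
  "coinv_class n f = coinv_ideal n +>\<^bsub>spoly_ring n\<^esub> f"

text \<open>The quotient \<open>spoly_ring n Quot coinv_ideal n\<close> together with its scalar multiplication over
  the complex numbers.\<close>

definition coinv_alg :: "nat \<Rightarrow> (complex, spoly set) module" where
  "coinv_alg n =
     (let Q = spoly_ring n Quot coinv_ideal n in
      \<lparr>carrier = carrier Q, mult = mult Q, one = one Q, zero = zero Q, add = add Q,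
       smult = (\<lambda>c X. coinv_class n (spoly_const c) \<otimes>\<^bsub>Q\<^esub> X)\<rparr>)"

fun tridegree :: "smonom \<Rightarrow> nat \<times> nat \<times> nat" where
  "tridegree (\<alpha>, T, S) =
     ((\<Sum>i \<in> Poly_Mapping.keys \<alpha>. Poly_Mapping.lookup \<alpha> i), card T, card S)"

definition coinv_component :: "nat \<Rightarrow> nat \<Rightarrow> nat \<Rightarrow> nat \<Rightarrow> spoly set set" where
  "coinv_component n a b c =
     coinv_class n `
       {f \<in> carrier (spoly_ring n). \<forall>m \<in> Poly_Mapping.keys f. tridegree m = (a, b, c)}"

text \<open>A series in \<open>q, u, v\<close> is a nested formal power series: outermost in \<open>q\<close>, innermost in \<open>v\<close>.\<close>

definition hilbert_series :: "nat \<Rightarrow> int fps fps fps" where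
  "hilbert_series n =
     Abs_fps (\<lambda>a. Abs_fps (\<lambda>b. Abs_fps (\<lambda>c.
       int (vectorspace.dim class_ring (coinv_alg n \<lparr>carrier := coinv_component n a b c\<rparr>)))))"

definition q_var :: "int fps fps fps" where "q_var = fps_X"
definition u_var :: "int fps fps fps" where "u_var = fps_const fps_X"
definition v_var :: "int fps fps fps" where "v_var = fps_const (fps_const fps_X)"


section \<open>Decorated lattice paths\<close>

text \<open>The indices of the variables decorating the \<open>i\<close>-th step are all \<open>i\<close>, so a step only records
  which kinds of variables occur.\<close>

datatype step = Up | Level_theta | Level_xi | Down_theta_xi

fun step_vector :: "step \<Rightarrow> int \<times> int" where
  "step_vector Up = (1, 1)"
| "step_vector Level_theta = (1, 0)"
| "step_vector Level_xi = (1, 0)"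
| "step_vector Down_theta_xi = (1, -1)"

text \<open>Lists are indexed from \<open>0\<close>, so the \<open>i\<close>-th step of \<open>\<pi>\<close> is \<open>\<pi> ! (i - 1)\<close>.\<close>

definition vertex :: "step list \<Rightarrow> nat \<Rightarrow> int \<times> int" where
  "vertex \<pi> i = (\<Sum>j = 1..i. step_vector (\<pi> ! (j - 1)))"

definition Paths_nonneg :: "nat \<Rightarrow> step list set" where
  "Paths_nonneg n = {\<pi>. length \<pi> = n \<and> (\<forall>i \<le> n. 0 \<le> snd (vertex \<pi> i))}"

definition T_set :: "step list \<Rightarrow> nat set" where
  "T_set \<pi> = {i \<in> {1..length \<pi>}. \<pi> ! (i - 1) \<in> {Level_theta, Down_theta_xi}}"

definition S_set :: "step list \<Rightarrow> nat set" where
  "S_set \<pi> = {i \<in> {1..length \<pi>}. \<pi> ! (i - 1) \<in> {Level_xi, Down_theta_xi}}"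

definition deg_theta :: "step list \<Rightarrow> nat" where "deg_theta \<pi> = card (T_set \<pi>)"
definition deg_xi :: "step list \<Rightarrow> nat" where "deg_xi \<pi> = card (S_set \<pi>)"

text \<open>The value at index \<open>0\<close> is a dummy.\<close>

fun beta :: "nat set \<Rightarrow> nat set \<Rightarrow> nat \<Rightarrow> int" where
  "beta T S 0 = 0"
| "beta T S (Suc 0) = - 1 + of_bool (1 \<notin> T) + of_bool (1 \<notin> S)"
| "beta T S (Suc (Suc i)) = beta T S (Suc i) - 2
     + of_bool (Suc (Suc i) \<notin> T) + of_bool (Suc i \<notin> T)
     + of_bool (Suc (Suc i) \<notin> S) + of_bool (Suc i \<notin> S)"

definition B_set :: "nat \<Rightarrow> spoly set" where
  "B_set n = {Poly_Mapping.single (b, T, S) 1 | b T S.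
     (\<exists>\<pi> \<in> Paths_nonneg n. T = T_set \<pi> \<and> S = S_set \<pi>) \<and>
     Poly_Mapping.keys b \<subseteq> {1..n} \<and>
     (\<forall>i \<in> {1..n}. int (Poly_Mapping.lookup b i) \<le> beta T S i)}"

definition q_int :: "int \<Rightarrow> int fps fps fps" where
  "q_int m = (\<Sum>k < nat m. q_var ^ k)"

definition stair_B :: "nat \<Rightarrow> step list \<Rightarrow> int fps fps fps" where
  "stair_B n \<pi> = (\<Prod>i = 1..n. q_int (beta (T_set \<pi>) (S_set \<pi>) i + 1))"


section \<open>Well-definedness: the quotient is a complex vector space and its components are subspaces\<close>

lemma spoly_mult_superset:
  assumes "finite A" "Poly_Mapping.keys p \<subseteq> A" "finite B" "Poly_Mapping.keys q \<subseteq> B"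
  shows "spoly_mult p q = (\<Sum>m\<in>A. \<Sum>m'\<in>B. Poly_Mapping.single (smonom_join m m') (smonom_sign m m' * Poly_Mapping.lookup p m * Poly_Mapping.lookup q m'))"
proof -
  have "spoly_mult p q = (\<Sum>m\<in>Poly_Mapping.keys p. \<Sum>m'\<in>B. Poly_Mapping.single (smonom_join m m') (smonom_sign m m' * Poly_Mapping.lookup p m * Poly_Mapping.lookup q m'))"
    unfolding spoly_mult_def
    by (intro sum.cong refl sum.mono_neutral_left) (use assms in \<open>auto simp: in_keys_iff\<close>)
  also have "\<dots> = (\<Sum>m\<in>A. \<Sum>m'\<in>B. Poly_Mapping.single (smonom_join m m') (smonom_sign m m' * Poly_Mapping.lookup p m * Poly_Mapping.lookup q m'))"
    by (intro sum.mono_neutral_left) (use assms in \<open>auto simp: in_keys_iff\<close>)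
  finally show ?thesis .
qed

lemma spoly_mult_add_left: "spoly_mult (p + p') q = spoly_mult p q + spoly_mult p' q"
proof -
  have s: "Poly_Mapping.keys (p + p') \<subseteq> Poly_Mapping.keys p \<union> Poly_Mapping.keys p'" by (rule Poly_Mapping.keys_add)
  show ?thesis
    using s by (simp add: spoly_mult_superset[where A = "Poly_Mapping.keys p \<union> Poly_Mapping.keys p'" and B = "Poly_Mapping.keys q"] lookup_add
        single_add[symmetric] sum.distrib[symmetric] algebra_simps)
qed

lemma spoly_mult_add_right: "spoly_mult q (p + p') = spoly_mult q p + spoly_mult q p'"
proof -
  have s: "Poly_Mapping.keys (p + p') \<subseteq> Poly_Mapping.keys p \<union> Poly_Mapping.keys p'" by (rule Poly_Mapping.keys_add)
  show ?thesis
    using s by (simp add: spoly_mult_superset[where B = "Poly_Mapping.keys p \<union> Poly_Mapping.keys p'" and A = "Poly_Mapping.keys q"] lookup_add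
        single_add[symmetric] sum.distrib[symmetric] algebra_simps)
qed

lemma spoly_mult_0 [simp]: "spoly_mult 0 q = 0" "spoly_mult q 0 = 0"
  by (simp_all add: spoly_mult_def)

lemma spoly_mult_sum_left: "spoly_mult (sum f A) q = (\<Sum>a\<in>A. spoly_mult (f a) q)"
  by (induction A rule: infinite_finite_induct) (auto simp: spoly_mult_add_left)
lemma spoly_mult_sum_right: "spoly_mult q (sum f A) = (\<Sum>a\<in>A. spoly_mult q (f a))"
  by (induction A rule: infinite_finite_induct) (auto simp: spoly_mult_add_right)

lemma spoly_mult_single:
  "spoly_mult (Poly_Mapping.single m c) (Poly_Mapping.single m' d) = Poly_Mapping.single (smonom_join m m') (smonom_sign m m' * c * d)"
  by (subst spoly_mult_superset[where A="{m}" and B="{m'}"]) auto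

lemma spoly_sum: "p = (\<Sum>m\<in>Poly_Mapping.keys p. Poly_Mapping.single m (Poly_Mapping.lookup p m))"
  by (rule poly_mapping_eqI)
     (auto simp: lookup_sum lookup_single when_def sum.delta in_keys_iff)

lemma crossings_Un1: assumes "finite A" "finite B" "finite C" "A \<inter> B = {}"
  shows "crossings (A \<union> B) C = crossings A C + crossings B C"
proof -
  have fin: "finite {(a, b). a \<in> A \<and> b \<in> C \<and> b < a}" if "finite A" for A
    by (rule finite_subset[of _ "A \<times> C"]) (use that assms in auto)
  have "{(a, b). a \<in> A \<union> B \<and> b \<in> C \<and> b < a} = {(a, b). a \<in> A \<and> b \<in> C \<and> b < a} \<union> {(a, b). a \<in> B \<and> b \<in> C \<and> b < a}" by auto
  then show ?thesis unfolding crossings_def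
    using card_Un_disjoint[OF fin[OF assms(1)] fin[OF assms(2)]] assms(4) by auto
qed
lemma crossings_Un2: assumes "finite A" "finite B" "finite C" "A \<inter> B = {}"
  shows "crossings C (A \<union> B) = crossings C A + crossings C B"
proof -
  have fin: "finite {(a, b). a \<in> C \<and> b \<in> A \<and> b < a}" if "finite A" for A
    by (rule finite_subset[of _ "C \<times> A"]) (use that assms in auto)
  have "{(a, b). a \<in> C \<and> b \<in> A \<union> B \<and> b < a} = {(a, b). a \<in> C \<and> b \<in> A \<and> b < a} \<union> {(a, b). a \<in> C \<and> b \<in> B \<and> b < a}" by auto
  then show ?thesis unfolding crossings_def
    using card_Un_disjoint[OF fin[OF assms(1)] fin[OF assms(2)]] assms(4) by auto
qed

lemma smonom_join_assoc: "smonom_join (smonom_join a b) c = smonom_join a (smonom_join b c)"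
  by (cases a; cases b; cases c) (auto simp: add.assoc)

lemma smonom_sign_assoc:
  assumes "a \<in> smonoms n" "b \<in> smonoms n" "c \<in> smonoms n"
  shows "smonom_sign a b * smonom_sign (smonom_join a b) c = smonom_sign b c * smonom_sign a (smonom_join b c)"
proof -
  obtain \<alpha> T S where a: "a = (\<alpha>, T, S)" by (cases a)
  obtain \<beta> T' S' where b: "b = (\<beta>, T', S')" by (cases b)
  obtain \<gamma> T'' S'' where c: "c = (\<gamma>, T'', S'')" by (cases c)
  have fin: "finite T" "finite S" "finite T'" "finite S'" "finite T''" "finite S''"
    using assms unfolding a b c smonoms_def by (auto intro: finite_subset)
  show ?thesis
  proof (cases "T \<inter> T' = {} \<and> S \<inter> S' = {} \<and> T \<inter> T'' = {} \<and> S \<inter> S'' = {} \<and> T' \<inter> T'' = {} \<and> S' \<inter> S'' = {}")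
    case True
    then have
      "crossings (T \<union> T') T'' = crossings T T'' + crossings T' T''"
      "crossings (S \<union> S') S'' = crossings S S'' + crossings S' S''"
      "crossings T (T' \<union> T'') = crossings T T' + crossings T T''"
      "crossings S (S' \<union> S'') = crossings S S' + crossings S S''"
      "card (S \<union> S') = card S + card S'" "card (T' \<union> T'') = card T' + card T''"
      "(T \<union> T') \<inter> T'' = {}" "(S \<union> S') \<inter> S'' = {}" "T \<inter> (T' \<union> T'') = {}" "S \<inter> (S' \<union> S'') = {}"
      by (simp_all add: crossings_Un1 crossings_Un2 fin card_Un_disjoint Int_Un_distrib Int_Un_distrib2)
    with True show ?thesis
      unfolding a b c
      by (simp add: power_add[symmetric] ring_distribs) (simp only: ac_simps)
  next
    case False
    then have "smonom_sign a b = 0 \<or> smonom_sign (smonom_join a b) c = 0"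
      "smonom_sign b c = 0 \<or> smonom_sign a (smonom_join b c) = 0"
      unfolding a b c by (simp_all add: Int_Un_distrib Int_Un_distrib2) argo+
    then show ?thesis by (metis mult_zero_left mult_zero_right)
  qed
qed

lemma keys_spoly_mult: "Poly_Mapping.keys p \<subseteq> smonoms n \<Longrightarrow> Poly_Mapping.keys q \<subseteq> smonoms n \<Longrightarrow> Poly_Mapping.keys (spoly_mult p q) \<subseteq> smonoms n"
proof -
  assume a: "Poly_Mapping.keys p \<subseteq> smonoms n" "Poly_Mapping.keys q \<subseteq> smonoms n"
  have j: "smonom_join m m' \<in> smonoms n" if "m \<in> smonoms n" "m' \<in> smonoms n" for m m'
    using that by (cases m; cases m') (auto simp: smonoms_def dest!: subsetD[OF Poly_Mapping.keys_add])
  have "Poly_Mapping.keys (spoly_mult p q) \<subseteq> (\<Union>m\<in>Poly_Mapping.keys p. \<Union>m'\<in>Poly_Mapping.keys q. {smonom_join m m'})"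
    unfolding spoly_mult_def
    by (rule order.trans[OF Poly_Mapping.keys_sum] UN_mono order.refl)+
       (auto split: if_splits)
  then show ?thesis using a j by blast
qed

lemma spoly_mult_assoc:
  assumes "Poly_Mapping.keys p \<subseteq> smonoms n" "Poly_Mapping.keys q \<subseteq> smonoms n" "Poly_Mapping.keys r \<subseteq> smonoms n"
  shows "spoly_mult (spoly_mult p q) r = spoly_mult p (spoly_mult q r)"
proof -
  have "spoly_mult (spoly_mult p q) r =
     (\<Sum>c\<in>Poly_Mapping.keys r. \<Sum>b\<in>Poly_Mapping.keys q. \<Sum>a\<in>Poly_Mapping.keys p. spoly_mult (spoly_mult (Poly_Mapping.single a (Poly_Mapping.lookup p a)) (Poly_Mapping.single b (Poly_Mapping.lookup q b))) (Poly_Mapping.single c (Poly_Mapping.lookup r c)))"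
    by (simp only: spoly_mult_sum_left[symmetric] spoly_mult_sum_right[symmetric] spoly_sum[symmetric])
  also have "\<dots> = (\<Sum>c\<in>Poly_Mapping.keys r. \<Sum>b\<in>Poly_Mapping.keys q. \<Sum>a\<in>Poly_Mapping.keys p. spoly_mult (Poly_Mapping.single a (Poly_Mapping.lookup p a)) (spoly_mult (Poly_Mapping.single b (Poly_Mapping.lookup q b)) (Poly_Mapping.single c (Poly_Mapping.lookup r c))))"
  proof (intro sum.cong refl)
    fix a b c assume "a \<in> Poly_Mapping.keys p" "b \<in> Poly_Mapping.keys q" "c \<in> Poly_Mapping.keys r"
    then have abc: "a \<in> smonoms n" "b \<in> smonoms n" "c \<in> smonoms n" using assms by auto
    have e: "smonom_sign (smonom_join a b) c * (smonom_sign a b * x * y) * z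
      = smonom_sign a (smonom_join b c) * x * (smonom_sign b c * y * z)" for x y z
    proof -
      have "smonom_sign (smonom_join a b) c * (smonom_sign a b * x * y) * z
        = (smonom_sign a b * smonom_sign (smonom_join a b) c) * (x * y * z)" by (simp only: ac_simps)
      also have "\<dots> = (smonom_sign b c * smonom_sign a (smonom_join b c)) * (x * y * z)"
        by (simp only: smonom_sign_assoc[OF abc])
      also have "\<dots> = smonom_sign a (smonom_join b c) * x * (smonom_sign b c * y * z)"
        by (simp only: ac_simps)
      finally show ?thesis .
    qed
    show "spoly_mult (spoly_mult (Poly_Mapping.single a (Poly_Mapping.lookup p a))
           (Poly_Mapping.single b (Poly_Mapping.lookup q b))) (Poly_Mapping.single c (Poly_Mapping.lookup r c))
      = spoly_mult (Poly_Mapping.single a (Poly_Mapping.lookup p a))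
          (spoly_mult (Poly_Mapping.single b (Poly_Mapping.lookup q b)) (Poly_Mapping.single c (Poly_Mapping.lookup r c)))"
      by (simp only: spoly_mult_single smonom_join_assoc e)
  qed
  also have "\<dots> = spoly_mult p (spoly_mult q r)"
    by (simp only: spoly_mult_sum_left[symmetric] spoly_mult_sum_right[symmetric] spoly_sum[symmetric])
  finally show ?thesis .
qed

lemma crossings_empty [simp]: "crossings {} A = 0" "crossings A {} = 0"
  by (auto simp: crossings_def)

lemma spoly_const_mult: "spoly_mult (spoly_const c) p = (\<Sum>m\<in>Poly_Mapping.keys p. Poly_Mapping.single m (c * Poly_Mapping.lookup p m))"
  unfolding spoly_const_def
  by (subst spoly_mult_superset[where A = "{(0,{},{})}" and B = "Poly_Mapping.keys p"])
     (auto intro!: sum.cong)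
lemma spoly_mult_const: "spoly_mult p (spoly_const c) = (\<Sum>m\<in>Poly_Mapping.keys p. Poly_Mapping.single m (c * Poly_Mapping.lookup p m))"
  unfolding spoly_const_def
  by (subst spoly_mult_superset[where B = "{(0,{},{})}" and A = "Poly_Mapping.keys p"])
     (auto intro!: sum.cong simp: mult.commute)

lemma keys_spoly_const: "Poly_Mapping.keys (spoly_const c) \<subseteq> smonoms n"
  by (auto simp: spoly_const_def smonoms_def)

lemma ring_spoly: "ring (spoly_ring n)"
proof (rule ringI)
  show "abelian_group (spoly_ring n)"
  proof (rule abelian_groupI)
    fix x assume "x \<in> carrier (spoly_ring n)"
    then show "\<exists>y\<in>carrier (spoly_ring n). y \<oplus>\<^bsub>spoly_ring n\<^esub> x = \<zero>\<^bsub>spoly_ring n\<^esub>"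
      by (intro bexI[of _ "-x"]) (auto simp: spoly_ring_def)
  qed (use Poly_Mapping.keys_add in \<open>fastforce simp: spoly_ring_def algebra_simps\<close>)+
  show "monoid (spoly_ring n)"
    using keys_spoly_const[of 1 n]
    by (intro monoidI)
       (auto simp: spoly_ring_def spoly_mult_assoc spoly_const_mult spoly_mult_const spoly_sum[symmetric] dest: subsetD[OF keys_spoly_mult, rotated 2])
qed (auto simp: spoly_ring_def spoly_mult_add_left spoly_mult_add_right)

lemma invariants_carrier: "{f \<in> carrier (spoly_ring n).
        (\<forall>w \<in> signed_perms n. act_spoly n w f = f) \<and> Poly_Mapping.lookup f (0, {}, {}) = 0} \<subseteq> carrier (spoly_ring n)" by auto

lemma ideal_coinv: "ideal (coinv_ideal n) (spoly_ring n)"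
  unfolding coinv_ideal_def by (rule ring.genideal_ideal[OF ring_spoly invariants_carrier])

lemma spoly_const_add: "spoly_const (c + d) = spoly_const c + spoly_const d"
  by (simp add: spoly_const_def single_add)
lemma spoly_const_times: "spoly_const (c * d) = spoly_mult (spoly_const c) (spoly_const d)"
  by (simp add: spoly_const_def spoly_mult_single)

lemma vs_coinv: "vectorspace class_ring (coinv_alg n)"
proof -
  interpret R: ring "spoly_ring n" by (rule ring_spoly)
  interpret I: ideal "coinv_ideal n" "spoly_ring n" by (rule ideal_coinv)
  define Q where "Q = spoly_ring n Quot coinv_ideal n"
  interpret Q: ring Q unfolding Q_def by (rule I.quotient_is_ring)
  have hom: "coinv_class n \<in> Ring.ring_hom (spoly_ring n) Q"
    using I.rcos_ring_hom unfolding Q_def coinv_class_def[abs_def] by (simp add: eta_contract_eq)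
  interpret h: ring_hom_ring "spoly_ring n" Q "coinv_class n"
    by (rule ring_hom_ringI2[OF ring_spoly Q.ring_axioms hom])
  have c: "spoly_const c \<in> carrier (spoly_ring n)" for c using keys_spoly_const by (auto simp: spoly_ring_def)
  have A: "coinv_alg n = \<lparr>carrier = carrier Q, mult = mult Q, one = one Q, zero = zero Q, add = add Q,
       smult = (\<lambda>c X. coinv_class n (spoly_const c) \<otimes>\<^bsub>Q\<^esub> X)\<rparr>"
    by (simp add: coinv_alg_def Q_def Let_def)
  have cm: "cring (class_ring :: complex ring)" by unfold_locales
  have f: "field (class_ring :: complex ring)" by unfold_locales
  have ag: "abelian_group (coinv_alg n)"
    by (rule abelian_groupI) (simp_all add: A Q.a_ac Q.add.l_inv_ex)
  have h1: "coinv_class n (spoly_const (c + d)) = coinv_class n (spoly_const c) \<oplus>\<^bsub>Q\<^esub> coinv_class n (spoly_const d)" for c d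
    using h.hom_add[OF c c, of c d] by (simp add: spoly_const_add spoly_ring_def)
  have h2: "coinv_class n (spoly_const (c * d)) = coinv_class n (spoly_const c) \<otimes>\<^bsub>Q\<^esub> coinv_class n (spoly_const d)" for c d
    using h.hom_mult[OF c c, of c d] by (simp add: spoly_const_times spoly_ring_def)
  have h3: "coinv_class n (spoly_const 1) = \<one>\<^bsub>Q\<^esub>"
    using h.hom_one by (simp add: spoly_ring_def)
  have "module (class_ring :: complex ring) (coinv_alg n)"
    by (rule moduleI[OF cm ag]) (auto simp: A h1 h2 h3 Q.l_distr Q.r_distr Q.m_assoc c)
  then show ?thesis using f by (simp add: vectorspace_def)
qed

lemma coinv_class_hom: "coinv_class n \<in> Ring.ring_hom (spoly_ring n) (spoly_ring n Quot coinv_ideal n)"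
  using ideal.rcos_ring_hom[OF ideal_coinv] unfolding coinv_class_def[abs_def]
  by (simp add: eta_contract_eq)

lemma submodule_coinv_component: "submodule class_ring (coinv_component n a b c) (coinv_alg n)"
proof -
  define H where "H = {f \<in> carrier (spoly_ring n). \<forall>m \<in> Poly_Mapping.keys f. tridegree m = (a, b, c)}"
  have C: "coinv_component n a b c = coinv_class n ` H"
    by (simp add: coinv_component_def H_def)
  have H0: "0 \<in> H" by (simp add: H_def spoly_ring_def)
  have H_add: "f + g \<in> H" if "f \<in> H" "g \<in> H" for f g
    using that subsetD[OF Poly_Mapping.keys_add[of f g]] by (simp add: H_def spoly_ring_def) blast
  have H_scale: "spoly_mult (spoly_const r) f \<in> H" if "f \<in> H" for r f
  proof -
    have "Poly_Mapping.keys (spoly_mult (spoly_const r) f) \<subseteq> (\<Union>m\<in>Poly_Mapping.keys f. {m})"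
      unfolding spoly_const_mult
      by (rule order.trans[OF Poly_Mapping.keys_sum] UN_mono order.refl)+ (auto split: if_splits)
    then show ?thesis using that unfolding H_def spoly_ring_def by auto
  qed
  have Hc: "f \<in> carrier (spoly_ring n)" if "f \<in> H" for f using that by (simp add: H_def)
  have c: "spoly_const r \<in> carrier (spoly_ring n)" for r
    using keys_spoly_const by (auto simp: spoly_ring_def)
  define Q where "Q = spoly_ring n Quot coinv_ideal n"
  have hom: "coinv_class n \<in> Ring.ring_hom (spoly_ring n) Q"
    unfolding Q_def by (rule coinv_class_hom)
  have A: "coinv_alg n = \<lparr>carrier = carrier Q, mult = mult Q, one = one Q, zero = zero Q, add = add Q,
       smult = (\<lambda>c X. coinv_class n (spoly_const c) \<otimes>\<^bsub>Q\<^esub> X)\<rparr>"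
    by (simp add: coinv_alg_def Q_def Let_def)
  interpret I: ideal "coinv_ideal n" "spoly_ring n" by (rule ideal_coinv)
  have Qr: "ring Q" unfolding Q_def by (rule I.quotient_is_ring)
  have h0: "coinv_class n 0 = \<zero>\<^bsub>Q\<^esub>"
    using ring_hom_zero[OF hom ring_spoly Qr] by (simp add: spoly_ring_def)
  have hadd: "coinv_class n f \<oplus>\<^bsub>Q\<^esub> coinv_class n g = coinv_class n (f + g)" if "f \<in> H" "g \<in> H" for f g
    using ring_hom_add[OF hom Hc[OF that(1)] Hc[OF that(2)]] by (simp add: spoly_ring_def)
  have hmult: "coinv_class n (spoly_const r) \<otimes>\<^bsub>Q\<^esub> coinv_class n f = coinv_class n (spoly_mult (spoly_const r) f)"
    if "f \<in> H" for r f
    using ring_hom_mult[OF hom c Hc[OF that], of r] by (simp add: spoly_ring_def)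
  show ?thesis
  proof (rule LinearCombinations.submodule.intro)
    show "module class_ring (coinv_alg n)"
      using vs_coinv by (simp add: vectorspace_def)
    show "coinv_component n a b c \<subseteq> carrier (coinv_alg n)"
      using ring_hom_closed[OF hom Hc] by (auto simp: A C)
    show "\<zero>\<^bsub>coinv_alg n\<^esub> \<in> coinv_component n a b c"
      using imageI[OF H0, of "coinv_class n"] by (simp add: A C h0)
    show "v \<oplus>\<^bsub>coinv_alg n\<^esub> w \<in> coinv_component n a b c"
      if "v \<in> coinv_component n a b c" "w \<in> coinv_component n a b c" for v w
    proof -
      from that obtain f g where "f \<in> H" "g \<in> H" "v = coinv_class n f" "w = coinv_class n g"
        unfolding C by blast
      then show ?thesis by (simp add: A C hadd H_add)
    qed
    show "r \<odot>\<^bsub>coinv_alg n\<^esub> v \<in> coinv_component n a b c"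
      if "r \<in> carrier class_ring" "v \<in> coinv_component n a b c" for r v
    proof -
      from that obtain f where "f \<in> H" "v = coinv_class n f"
        unfolding C by blast
      then show ?thesis by (simp add: A C hmult H_scale)
    qed
  qed
qed

end

theory Submission
  imports Defs
begin

text \<open>The action preserves the tridegree, so the invariants without constant term, and hence the
  ideal generated by them, are closed under taking homogeneous parts.  Thus the basis elements of a
  given tridegree span the corresponding component of the quotient, and its dimension is their
  number.  Expanding the product of the \<open>q\<close>-integers counts the same monomials by degree; when some
  \<open>\<beta>\<^sub>i\<close> is negative, both the set of exponents and the product vanish.\<close>

section \<open>Homogeneous parts\<close>

text \<open>The image of this set under \<open>coinv_class\<close> is
  \<open>coinv_component\<close>. It contains 0 for every \<open>d\<close>, so products that vanish
  fit in without a case distinction.\<close>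

definition homogeneous :: "nat \<Rightarrow> nat \<times> nat \<times> nat \<Rightarrow> spoly set" where
  "homogeneous n d = {f \<in> carrier (spoly_ring n). \<forall>m \<in> Poly_Mapping.keys f. tridegree m = d}"

definition hom_part :: "nat \<times> nat \<times> nat \<Rightarrow> spoly \<Rightarrow> spoly" where
  "hom_part d p = (\<Sum>m \<in> {m \<in> Poly_Mapping.keys p. tridegree m = d}.
     Poly_Mapping.single m (Poly_Mapping.lookup p m))"

lemma spoly_ring_simps [simp]:
  "mult (spoly_ring n) = spoly_mult" "one (spoly_ring n) = spoly_const 1"
  "zero (spoly_ring n) = 0" "add (spoly_ring n) = (+)"
  by (simp_all add: spoly_ring_def)

lemma carrier_spoly_ring: "p \<in> carrier (spoly_ring n) \<longleftrightarrow> Poly_Mapping.keys p \<subseteq> smonoms n"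
  by (simp add: spoly_ring_def)

lemma lookup_hom_part:
  "Poly_Mapping.lookup (hom_part d p) m = (if tridegree m = d then Poly_Mapping.lookup p m else 0)"
  by (auto simp: hom_part_def lookup_sum lookup_single when_def sum.delta' in_keys_iff)

lemma keys_hom_part:
  "Poly_Mapping.keys (hom_part d p) = {m \<in> Poly_Mapping.keys p. tridegree m = d}"
  by (auto simp: in_keys_iff lookup_hom_part split: if_splits)

lemma hom_part_add: "hom_part d (p + q) = hom_part d p + hom_part d q"
  by (rule poly_mapping_eqI) (simp add: lookup_hom_part lookup_add)

lemma hom_part_minus: "hom_part d (p - q) = hom_part d p - hom_part d q"
  by (rule poly_mapping_eqI) (simp add: lookup_hom_part lookup_minus)

lemma hom_part_0 [simp]: "hom_part d 0 = 0"
  by (rule poly_mapping_eqI) (simp add: lookup_hom_part)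

lemma hom_part_sum: "hom_part d (sum f A) = (\<Sum>a\<in>A. hom_part d (f a))"
  by (induction A rule: infinite_finite_induct) (simp_all add: hom_part_add)

lemma hom_part_homogeneous:
  assumes "p \<in> homogeneous n e"
  shows "hom_part d p = (if e = d then p else 0)"
proof (rule poly_mapping_eqI)
  fix m
  show "Poly_Mapping.lookup (hom_part d p) m = Poly_Mapping.lookup (if e = d then p else 0) m"
    using assms by (cases "m \<in> Poly_Mapping.keys p")
      (auto simp: lookup_hom_part homogeneous_def in_keys_iff)
qed

lemma hom_part_in_homogeneous:
  "p \<in> carrier (spoly_ring n) \<Longrightarrow> hom_part d p \<in> homogeneous n d"
  by (auto simp: homogeneous_def keys_hom_part carrier_spoly_ring)

lemma sum_hom_part: "(\<Sum>d \<in> tridegree ` Poly_Mapping.keys p. hom_part d p) = p"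
  by (rule poly_mapping_eqI) (auto simp: lookup_sum lookup_hom_part sum.delta' in_keys_iff)

text \<open>A nonzero sign means that no anticommuting variable is repeated, so the unions are
  disjoint and their cardinalities add up. Membership in \<open>smonoms n\<close> supplies the
  finiteness that \<open>card\<close> requires.\<close>

lemma tridegree_join:
  assumes "m \<in> smonoms n" "m' \<in> smonoms n" "smonom_sign m m' \<noteq> 0"
  shows "tridegree (smonom_join m m') = tridegree m + tridegree m'"
proof -
  obtain \<alpha> T S \<beta> T' S' where m: "m = (\<alpha>, T, S)" "m' = (\<beta>, T', S')"
    by (metis prod_cases3)
  have fin: "finite T" "finite S" "finite T'" "finite S'"
    using assms(1,2) by (auto simp: m smonoms_def intro: finite_subset)
  \<comment> \<open>The three exponent sums run over different supports; all of them are extended by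
    zeros to the common index set.\<close>
  have deg: "(\<Sum>i \<in> Poly_Mapping.keys \<gamma>. Poly_Mapping.lookup \<gamma> i)
      = (\<Sum>i \<in> Poly_Mapping.keys \<alpha> \<union> Poly_Mapping.keys \<beta>. Poly_Mapping.lookup \<gamma> i)"
    if "Poly_Mapping.keys \<gamma> \<subseteq> Poly_Mapping.keys \<alpha> \<union> Poly_Mapping.keys \<beta>" for \<gamma> :: "nat \<Rightarrow>\<^sub>0 nat"
    by (rule sum.mono_neutral_left) (use that in \<open>auto simp: in_keys_iff\<close>)
  have "(\<Sum>i \<in> Poly_Mapping.keys (\<alpha> + \<beta>). Poly_Mapping.lookup (\<alpha> + \<beta>) i)
      = (\<Sum>i \<in> Poly_Mapping.keys \<alpha> \<union> Poly_Mapping.keys \<beta>. Poly_Mapping.lookup (\<alpha> + \<beta>) i)"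
    by (rule deg[OF Poly_Mapping.keys_add])
  also have "\<dots> = (\<Sum>i \<in> Poly_Mapping.keys \<alpha>. Poly_Mapping.lookup \<alpha> i)
        + (\<Sum>i \<in> Poly_Mapping.keys \<beta>. Poly_Mapping.lookup \<beta> i)"
    by (simp add: deg[of \<alpha>] deg[of \<beta>] lookup_add sum.distrib)
  finally show ?thesis
    using assms(3) fin by (auto simp: m card_Un_disjoint split: if_splits)
qed

lemma homogeneous_mult:
  assumes "p \<in> homogeneous n d" "q \<in> homogeneous n e"
  shows "spoly_mult p q \<in> homogeneous n (d + e)"
proof -
  have "tridegree k = d + e" if kp: "k \<in> Poly_Mapping.keys (spoly_mult p q)" for k
  proof -
    obtain m where m: "m \<in> Poly_Mapping.keys p"
      and km: "k \<in> Poly_Mapping.keys (\<Sum>m'\<in>Poly_Mapping.keys q. Poly_Mapping.single (smonom_join m m')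
          (smonom_sign m m' * Poly_Mapping.lookup p m * Poly_Mapping.lookup q m'))"
      using subsetD[OF Poly_Mapping.keys_sum kp[unfolded spoly_mult_def]] by (rule UN_E)
    obtain m' where m': "m' \<in> Poly_Mapping.keys q"
      and k: "k \<in> Poly_Mapping.keys (Poly_Mapping.single (smonom_join m m')
          (smonom_sign m m' * Poly_Mapping.lookup p m * Poly_Mapping.lookup q m'))"
      using subsetD[OF Poly_Mapping.keys_sum km] by (rule UN_E)
    \<comment> \<open>A key of a \<open>single\<close> forces its coefficient, and with it the sign,
      to be nonzero, as \<open>tridegree_join\<close> demands.\<close>
    have "k = smonom_join m m'" "smonom_sign m m' \<noteq> 0"
      using k by (auto simp del: smonom_join.simps smonom_sign.simps split: if_splits)
    moreover have "m \<in> smonoms n" "m' \<in> smonoms n" "tridegree m = d" "tridegree m' = e"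
      using m m' assms by (auto simp: homogeneous_def carrier_spoly_ring)
    ultimately show ?thesis using tridegree_join[of m n m'] by simp
  qed
  moreover have "Poly_Mapping.keys (spoly_mult p q) \<subseteq> smonoms n"
    using assms by (intro keys_spoly_mult) (simp_all add: homogeneous_def carrier_spoly_ring)
  ultimately show ?thesis by (simp add: homogeneous_def carrier_spoly_ring)
qed

lemma homogeneous_const: "spoly_const c \<in> homogeneous n 0"
  using keys_spoly_const[of c n]
  by (auto simp: homogeneous_def carrier_spoly_ring zero_prod_def spoly_const_def split: if_splits)

lemma homogeneous_const_mult: "p \<in> homogeneous n d \<Longrightarrow> spoly_mult (spoly_const c) p \<in> homogeneous n d"
  using homogeneous_mult[OF homogeneous_const] by fastforce

lemma homogeneous_ordered_prod:
  assumes "\<And>i. i \<in> set is \<Longrightarrow> f i \<in> homogeneous n (d i)"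
  shows "ordered_prod (spoly_ring n) (map f is) \<in> homogeneous n (\<Sum>i\<leftarrow>is. d i)"
  using assms
  by (induction "is") (auto simp: ordered_prod_def homogeneous_const homogeneous_mult)

lemma homogeneous_pow:
  assumes "p \<in> homogeneous n (a, b, c)"
  shows "p [^]\<^bsub>spoly_ring n\<^esub> (k::nat) \<in> homogeneous n (k * a, k * b, k * c)"
proof (induction k)
  case 0
  then show ?case
    using homogeneous_const[of 1 n] by (simp add: nat_pow_def zero_prod_def)
next
  case (Suc k)
  then show ?case
    using homogeneous_mult[OF Suc assms] by (simp add: nat_pow_def add.commute)
qed

section \<open>Homogeneity of the ideal\<close>

lemma signed_perms_range:
  assumes "w \<in> signed_perms n" "i \<in> {1..n}"
  shows "nat \<bar>w (int i)\<bar> \<in> {1..n}"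
proof -
  have "w (int i) \<in> {- int n..int n} - {0}"
    using assms by (subst permutes_in_image[of w]) (auto simp: signed_perms_def)
  then show ?thesis by auto
qed

text \<open>Up to a sign, which is a scalar of degree 0, the image of a variable is a variable of
  the same kind, with index still in \<open>{1..n}\<close>.\<close>

lemma act_var_homogeneous:
  assumes "w \<in> signed_perms n" "i \<in> {1..n}"
  shows "act_var n w x_var i \<in> homogeneous n (1, 0, 0)"
    "act_var n w theta_var i \<in> homogeneous n (0, 1, 0)"
    "act_var n w xi_var i \<in> homogeneous n (0, 0, 1)"
  unfolding act_var_def spoly_ring_simps using signed_perms_range[OF assms]
  by (intro homogeneous_const_mult;
      simp add: homogeneous_def carrier_spoly_ring x_var_def theta_var_def xi_var_def smonoms_def)+

lemma sum_list_triple: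
  "(\<Sum>i\<leftarrow>is. (f i, g i, h i)) = (\<Sum>i\<leftarrow>is. f i, \<Sum>i\<leftarrow>is. g i, \<Sum>i\<leftarrow>is. h i)"
  by (induction "is") (auto simp: zero_prod_def)

text \<open>The image is a product of images of single variables, each homogeneous of the degree of
  its variable. Counting the factors of each kind gives the exponent sum, \<open>card T\<close> and
  \<open>card S\<close>.\<close>

lemma act_smonom_homogeneous:
  assumes "w \<in> signed_perms n" "m \<in> smonoms n"
  shows "act_smonom n w m \<in> homogeneous n (tridegree m)"
proof -
  obtain \<alpha> T S where m: "m = (\<alpha>, T, S)" by (cases m)
  have sub: "Poly_Mapping.keys \<alpha> \<subseteq> {1..n}" "T \<subseteq> {1..n}" "S \<subseteq> {1..n}"
    using assms(2) by (auto simp: m smonoms_def)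
  then have fin: "finite T" "finite S" by (auto intro: finite_subset)
  have x: "ordered_prod (spoly_ring n)
      (map (\<lambda>i. act_var n w x_var i [^]\<^bsub>spoly_ring n\<^esub> Poly_Mapping.lookup \<alpha> i) [1..<n + 1])
      \<in> homogeneous n (\<Sum>i\<leftarrow>[1..<n + 1]. (Poly_Mapping.lookup \<alpha> i, 0, 0))"
    using homogeneous_pow[OF act_var_homogeneous(1)[OF assms(1)]]
    by (intro homogeneous_ordered_prod) force
  have theta: "ordered_prod (spoly_ring n) (map (act_var n w theta_var) (sorted_list_of_set T))
      \<in> homogeneous n (\<Sum>i\<leftarrow>sorted_list_of_set T. (0, 1, 0))"
    using act_var_homogeneous(2)[OF assms(1)] sub fin by (intro homogeneous_ordered_prod) auto
  have xi: "ordered_prod (spoly_ring n) (map (act_var n w xi_var) (sorted_list_of_set S))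
      \<in> homogeneous n (\<Sum>i\<leftarrow>sorted_list_of_set S. (0, 0, 1))"
    using act_var_homogeneous(3)[OF assms(1)] sub fin by (intro homogeneous_ordered_prod) auto
  \<comment> \<open>The action multiplies over all indices, whereas \<open>tridegree\<close> sums
    over the support; the additional exponents are 0.\<close>
  have "(\<Sum>i\<leftarrow>[1..<n + 1]. Poly_Mapping.lookup \<alpha> i) = (\<Sum>i\<in>{1..n}. Poly_Mapping.lookup \<alpha> i)"
    by (subst sum_list_distinct_conv_sum_set) (auto intro: sum.cong)
  also have "\<dots> = (\<Sum>i\<in>Poly_Mapping.keys \<alpha>. Poly_Mapping.lookup \<alpha> i)"
    by (rule sum.mono_neutral_right) (use sub in \<open>auto simp: in_keys_iff\<close>)
  finally show ?thesis
    using homogeneous_mult[OF homogeneous_mult[OF x theta] xi]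
    by (simp add: m sum_list_triple sum_list_triv)
qed

text \<open>\<open>act_spoly\<close> extends \<open>act_smonom\<close> linearly and each monomial
  keeps its tridegree, so both sides collect the images of the same monomials. In particular, the
  homogeneous parts of an invariant are invariant.\<close>

lemma hom_part_act:
  assumes "w \<in> signed_perms n" "p \<in> carrier (spoly_ring n)"
  shows "hom_part d (act_spoly n w p) = act_spoly n w (hom_part d p)"
proof -
  have *: "hom_part d (spoly_mult (spoly_const c) (act_smonom n w m))
      = (if tridegree m = d then spoly_mult (spoly_const c) (act_smonom n w m) else 0)"
    if "m \<in> Poly_Mapping.keys p" for c m
    using that assms
    by (intro hom_part_homogeneous[where n = n] homogeneous_const_mult act_smonom_homogeneous)
       (auto simp: carrier_spoly_ring)
  show ?thesis
    unfolding act_spoly_def hom_part_sum keys_hom_part spoly_ring_simps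
    by (auto simp: * lookup_hom_part sum.inter_filter intro!: sum.cong)
qed

text \<open>Split both factors into homogeneous parts: the degree \<open>d\<close> part of the
  product is the sum of the products of parts whose degrees add up to \<open>d\<close>. Stating this
  for two arbitrary factors makes it serve left and right multiplication alike.\<close>

lemma hom_part_mult_mem_ideal:
  assumes "ideal I (spoly_ring n)" "p \<in> carrier (spoly_ring n)" "q \<in> carrier (spoly_ring n)"
    and "\<And>d e. spoly_mult (hom_part d p) (hom_part e q) \<in> I"
  shows "hom_part d (spoly_mult p q) \<in> I"
proof -
  interpret I: ideal I "spoly_ring n" by fact
  have sum_I: "sum f A \<in> I" if "\<And>a. a \<in> A \<Longrightarrow> f a \<in> I" for f :: "nat \<times> nat \<times> nat \<Rightarrow> spoly" and A
    using that
  proof (induction A rule: infinite_finite_induct)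
    case (insert a A)
    then show ?case 
      using additive_subgroup.a_closed[OF I.additive_subgroup_axioms, of "f a" "sum f A"] by simp
  qed (use additive_subgroup.zero_closed[OF I.additive_subgroup_axioms] in simp_all)
  have "spoly_mult p q = (\<Sum>e\<in>tridegree ` Poly_Mapping.keys p. \<Sum>e'\<in>tridegree ` Poly_Mapping.keys q.
      spoly_mult (hom_part e p) (hom_part e' q))"
    by (simp flip: spoly_mult_sum_left spoly_mult_sum_right add: sum_hom_part)
  then have "hom_part d (spoly_mult p q) =
      (\<Sum>e\<in>tridegree ` Poly_Mapping.keys p. \<Sum>e'\<in>tridegree ` Poly_Mapping.keys q.
        if e + e' = d then spoly_mult (hom_part e p) (hom_part e' q) else 0)"
    using assms(2,3)
    by (simp add: hom_part_sum
        hom_part_homogeneous[OF homogeneous_mult[OF hom_part_in_homogeneous hom_part_in_homogeneous]])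
  also have "\<dots> \<in> I"
    using assms(4) additive_subgroup.zero_closed[OF I.additive_subgroup_axioms]
    by (intro sum_I) auto
  finally show ?thesis .
qed

text \<open>The elements all of whose homogeneous parts lie in the ideal form an ideal
  \<open>J\<close> themselves. It contains the generators \<open>G\<close>, so by minimality it
  contains the whole of \<open>coinv_ideal n\<close>.\<close>

lemma hom_part_coinv_ideal:
  assumes "p \<in> coinv_ideal n"
  shows "hom_part d p \<in> coinv_ideal n"
proof -
  define R where "R = spoly_ring n"
  define G where "G = {f \<in> carrier R.
    (\<forall>w \<in> signed_perms n. act_spoly n w f = f) \<and> Poly_Mapping.lookup f (0, {}, {}) = 0}"
  define J where "J = {p \<in> carrier R. \<forall>d. hom_part d p \<in> coinv_ideal n}"
  interpret R: ring R unfolding R_def by (rule ring_spoly)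
  interpret I: ideal "coinv_ideal n" R unfolding R_def by (rule ideal_coinv)
  have I_eq: "coinv_ideal n = Idl\<^bsub>R\<^esub> G"
    by (simp add: coinv_ideal_def G_def R_def)
  have carr: "hom_part d p \<in> carrier R" if "p \<in> carrier R" for d p
    using hom_part_in_homogeneous[of p n d] that by (simp add: R_def homogeneous_def)
  have J_part: "hom_part d p \<in> coinv_ideal n" "p \<in> carrier R" if "p \<in> J" for d p
    using that unfolding J_def by blast+
  have "ideal J R"
  proof (rule idealI[OF R.ring_axioms])
    show "subgroup J (add_monoid R)"
    proof (rule R.add.subgroupI)
      show "J \<noteq> {}" using I.zero_closed R.zero_closed by (auto simp: J_def R_def intro!: exI[of _ 0])
    next
      fix a assume a: "a \<in> J"
      \<comment> \<open>The inverse in the ring record is identified with pointwise negation, which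
        commutes with \<open>hom_part d\<close>.\<close>
      have "\<ominus>\<^bsub>R\<^esub> a = - a"
        using a R.minus_equality[of "- a" a] by (auto simp: J_def R_def carrier_spoly_ring)
      moreover have "\<ominus>\<^bsub>R\<^esub> hom_part d a = - hom_part d a" for d
        using carr[of a d] R.minus_equality[of "- hom_part d a" "hom_part d a"] a
        by (auto simp: J_def R_def carrier_spoly_ring)
      moreover have "hom_part d (- a) = - hom_part d a" for d
        using hom_part_minus[of d 0 a] by simp
      moreover have "\<ominus>\<^bsub>R\<^esub> hom_part d a \<in> coinv_ideal n" for d
        using a I.a_inv_closed[of "hom_part d a"] by (cases d) (auto simp: J_def)
      ultimately have "hom_part d (\<ominus>\<^bsub>R\<^esub> a) \<in> coinv_ideal n" for d
        by metis
      then show "\<ominus>\<^bsub>R\<^esub> a \<in> J"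
        using a R.a_inv_closed by (simp add: J_def)
    next
      fix a b assume "a \<in> J" "b \<in> J"
      then show "a \<oplus>\<^bsub>R\<^esub> b \<in> J"
        using R.a_closed[of a b] I.a_closed by (auto simp: J_def R_def hom_part_add)
    qed (simp add: J_def)
  next
    fix a x assume a: "a \<in> J" and x: "x \<in> carrier R"
    \<comment> \<open>The ring is not commutative, so absorption has to be checked on both
      sides.\<close>
    have "spoly_mult (hom_part d x) (hom_part e a) \<in> coinv_ideal n"
      "spoly_mult (hom_part e a) (hom_part d x) \<in> coinv_ideal n" for d e
      using I.I_l_closed[of "hom_part e a" "hom_part d x"] I.I_r_closed[of "hom_part e a" "hom_part d x"]
        J_part[OF a] x carr by (simp_all add: R_def)
    then have "hom_part d (spoly_mult x a) \<in> coinv_ideal n"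
      "hom_part d (spoly_mult a x) \<in> coinv_ideal n" for d
      using a x by (auto intro!: hom_part_mult_mem_ideal[OF ideal_coinv] simp: J_def R_def)
    then show "x \<otimes>\<^bsub>R\<^esub> a \<in> J" "a \<otimes>\<^bsub>R\<^esub> x \<in> J"
      using R.m_closed[of x a] R.m_closed[of a x] a x by (auto simp: J_def R_def)
  qed
  moreover have "G \<subseteq> J"
  proof
    fix f assume f: "f \<in> G"
    \<comment> \<open>Invariance passes to the parts by \<open>hom_part_act\<close>, and the
      constant coefficient of a part is either 0 or that of \<open>f\<close>, hence 0 as
      well.\<close>
    have "hom_part d f \<in> G" for d
      using f carr[of f d] by (auto simp: G_def R_def lookup_hom_part hom_part_act[symmetric])
    moreover have "G \<subseteq> coinv_ideal n"
      unfolding I_eq by (rule R.genideal_self) (auto simp: G_def)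
    ultimately show "f \<in> J" using f by (auto simp: J_def G_def)
  qed
  ultimately show ?thesis
    using R.genideal_minimal[of J G] J_part(1) assms unfolding I_eq[symmetric] by blast
qed

text \<open>This makes the homogeneous part well defined on the quotient: two representatives differ
  by an element of the ideal, whose degree \<open>d\<close> part is again in the ideal.\<close>

lemma hom_part_coinv_class:
  assumes "p \<in> carrier (spoly_ring n)" "q \<in> carrier (spoly_ring n)"
    and "coinv_class n p = coinv_class n q"
  shows "coinv_class n (hom_part d p) = coinv_class n (hom_part d q)"
proof -
  interpret R: ring "spoly_ring n" by (rule ring_spoly)
  interpret I: ideal "coinv_ideal n" "spoly_ring n" by (rule ideal_coinv)
  have "p \<in> coinv_ideal n +>\<^bsub>spoly_ring n\<^esub> q"
    using I.a_repr_independenceD[of p q] assms by (simp add: coinv_class_def)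
  then obtain h where h: "h \<in> coinv_ideal n" "p = h + q"
    by (auto simp: a_r_coset_def')
  have "hom_part d p \<in> coinv_ideal n +>\<^bsub>spoly_ring n\<^esub> hom_part d q"
    using hom_part_coinv_ideal[OF h(1), of d] by (auto simp: a_r_coset_def' h(2) hom_part_add)
  moreover have "hom_part d q \<in> carrier (spoly_ring n)"
    using hom_part_in_homogeneous[OF assms(2)] by (simp add: homogeneous_def)
  ultimately show ?thesis
    unfolding coinv_class_def by (metis I.a_repr_independence')
qed

section \<open>Dimensions of the components\<close>

text \<open>The classes of the monomials of degree \<open>d\<close> in \<open>M\<close> form a basis
  of the component. Independence is inherited from the full basis; spanning follows by projecting to
  degree \<open>d\<close>. Injectivity turns the number of classes into the number of
  monomials.\<close>

lemma dim_coinv_component: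
  assumes M: "finite M" "M \<subseteq> smonoms n"
    and inj: "inj_on (\<lambda>m. coinv_class n (Poly_Mapping.single m 1)) M"
    and basis: "vectorspace.basis class_ring (coinv_alg n)
      ((\<lambda>m. coinv_class n (Poly_Mapping.single m 1)) ` M)"
  shows "vectorspace.dim class_ring (coinv_alg n \<lparr>carrier := coinv_component n a b c\<rparr>)
    = card {m \<in> M. tridegree m = (a, b, c)}"
proof -
  define cl where "cl = (\<lambda>m. coinv_class n (Poly_Mapping.single m 1))"
  define d where "d = (a, b, c)"
  define W where "W = coinv_component n a b c"
  define Md where "Md = {m \<in> M. tridegree m = d}"
  define Q where "Q = spoly_ring n Quot coinv_ideal n"
  interpret V: vectorspace class_ring "coinv_alg n" by (rule vs_coinv)
  have subW: "LinearCombinations.submodule class_ring W (coinv_alg n)"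
    unfolding W_def by (rule submodule_coinv_component)
  interpret W: vectorspace class_ring "V.vs W"
    by (rule V.subspace_is_vs) (simp add: subspace_def vs_coinv subW)
  interpret R: ring "spoly_ring n" by (rule ring_spoly)
  have W_eq: "W = coinv_class n ` homogeneous n d"
    by (simp add: W_def coinv_component_def homogeneous_def d_def)
  have A: "coinv_alg n = \<lparr>carrier = carrier Q, mult = mult Q, one = one Q, zero = zero Q,
       add = add Q, smult = (\<lambda>c X. coinv_class n (spoly_const c) \<otimes>\<^bsub>Q\<^esub> X)\<rparr>"
    by (simp add: coinv_alg_def Q_def Let_def)
  have hom: "coinv_class n \<in> Ring.ring_hom (spoly_ring n) Q"
    unfolding Q_def by (rule coinv_class_hom)
  have Q: "ring Q" unfolding Q_def by (rule ideal.quotient_is_ring[OF ideal_coinv])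
  have const: "spoly_const r \<in> carrier (spoly_ring n)" for r
    by (simp add: carrier_spoly_ring keys_spoly_const)
  have class_0: "coinv_class n 0 = \<zero>\<^bsub>coinv_alg n\<^esub>"
    using ring_hom_zero[OF hom ring_spoly Q] by (simp add: A)
  have class_add: "coinv_class n (f + g) = coinv_class n f \<oplus>\<^bsub>coinv_alg n\<^esub> coinv_class n g"
    if "f \<in> carrier (spoly_ring n)" "g \<in> carrier (spoly_ring n)" for f g
    using ring_hom_add[OF hom that] by (simp add: A)
  have class_smult: "coinv_class n (spoly_mult (spoly_const r) f) = r \<odot>\<^bsub>coinv_alg n\<^esub> coinv_class n f"
    if "f \<in> carrier (spoly_ring n)" for r f
    using ring_hom_mult[OF hom const that, of r] by (simp add: A)
  have class_carrier: "coinv_class n f \<in> carrier (coinv_alg n)" if "f \<in> carrier (spoly_ring n)" for f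
    using ring_hom_closed[OF hom that] by (simp add: A)
  have hom_carrier: "hom_part e f \<in> carrier (spoly_ring n)" if "f \<in> carrier (spoly_ring n)" for e f
    using hom_part_in_homogeneous[OF that] by (simp add: homogeneous_def)
  have hom_smult: "hom_part e (spoly_mult (spoly_const r) f) = spoly_mult (spoly_const r) (hom_part e f)"
    for e r f
    by (rule poly_mapping_eqI)
       (auto simp: spoly_const_mult lookup_hom_part keys_hom_part lookup_sum lookup_single when_def
          sum.delta' in_keys_iff intro!: sum.neutral)
  have single_homogeneous: "Poly_Mapping.single m 1 \<in> homogeneous n (tridegree m)" if "m \<in> M" for m
    using that M by (auto simp: homogeneous_def carrier_spoly_ring)
  have clM: "cl ` M \<subseteq> carrier (coinv_alg n)"
    using single_homogeneous by (auto simp: cl_def homogeneous_def intro!: class_carrier)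
  have clMd_W: "cl ` Md \<subseteq> W"
    using single_homogeneous by (auto simp: W_eq cl_def Md_def)
  have clMd: "cl ` Md \<subseteq> cl ` M" by (auto simp: Md_def)
  have sub_span: "LinearCombinations.submodule class_ring (V.span (cl ` Md)) (coinv_alg n)"
    using clM clMd by (intro V.span_is_submodule) auto
  interpret S: LinearCombinations.submodule class_ring "V.span (cl ` Md)" "coinv_alg n"
    by (rule sub_span)
  \<comment> \<open>\<open>N\<close> consists of the classes with some representative whose degree
    \<open>d\<close> part has its class in the span. Showing that it is a submodule containing the
    full basis avoids explicit linear combinations.\<close>
  define N where "N = coinv_class n `
    {p \<in> carrier (spoly_ring n). coinv_class n (hom_part d p) \<in> V.span (cl ` Md)}"
  have "LinearCombinations.submodule class_ring N (coinv_alg n)"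
  proof (rule LinearCombinations.submodule.intro)
    show "module class_ring (coinv_alg n)" by (rule V.module_axioms)
    show "N \<subseteq> carrier (coinv_alg n)" by (auto simp: N_def class_carrier)
    show "\<zero>\<^bsub>coinv_alg n\<^esub> \<in> N"
      unfolding N_def class_0[symmetric]
      by (intro imageI) (simp add: class_0 carrier_spoly_ring)
    show "v \<oplus>\<^bsub>coinv_alg n\<^esub> w \<in> N" if vw: "v \<in> N" "w \<in> N" for v w
    proof -
      obtain f g where f: "f \<in> carrier (spoly_ring n)" "v = coinv_class n f"
          "coinv_class n (hom_part d f) \<in> V.span (cl ` Md)"
        and g: "g \<in> carrier (spoly_ring n)" "w = coinv_class n g"
          "coinv_class n (hom_part d g) \<in> V.span (cl ` Md)"
        using vw by (auto simp: N_def)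
      then show ?thesis
        using R.a_closed[OF f(1) g(1)]
        unfolding f(2) g(2) class_add[OF f(1) g(1), symmetric] N_def
        by (intro imageI) (simp add: hom_part_add class_add hom_carrier)
    qed
    show "r \<odot>\<^bsub>coinv_alg n\<^esub> v \<in> N" if rv: "r \<in> carrier class_ring" "v \<in> N" for r v
    proof -
      obtain f where f: "f \<in> carrier (spoly_ring n)" "v = coinv_class n f"
          "coinv_class n (hom_part d f) \<in> V.span (cl ` Md)"
        using rv by (auto simp: N_def)
      then show ?thesis
        using R.m_closed[OF const f(1), of r] rv(1)
        unfolding f(2) class_smult[OF f(1), symmetric] N_def
        by (intro imageI) (simp add: hom_smult class_smult hom_carrier)
    qed
  qed
  \<comment> \<open>The degree \<open>d\<close> part of a monomial in \<open>M\<close> is the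
    monomial itself, and then it lies in \<open>Md\<close>, or it is 0.\<close>
  moreover have "cl ` M \<subseteq> N"
  proof
    fix v assume "v \<in> cl ` M"
    then obtain m where m: "m \<in> M" "v = cl m" by auto
    have "coinv_class n (hom_part d (Poly_Mapping.single m 1)) \<in> V.span (cl ` Md)"
    proof (cases "tridegree m = d")
      case True
      then have "cl m \<in> V.span (cl ` Md)"
        using m V.in_own_span[of "cl ` Md"] clM clMd by (auto simp: Md_def)
      then show ?thesis
        using True hom_part_homogeneous[OF single_homogeneous[OF m(1)], of d] by (simp add: cl_def)
    next
      case False
      then show ?thesis
        using hom_part_homogeneous[OF single_homogeneous[OF m(1)], of d] by (simp add: class_0)
    qed
    then show "v \<in> N"
      using single_homogeneous[OF m(1)] unfolding m(2) cl_def N_def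
      by (intro imageI) (simp add: homogeneous_def)
  qed
  ultimately have "V.span (cl ` M) \<subseteq> N" by (intro V.span_is_subset)
  then have carrier_N: "carrier (coinv_alg n) \<subseteq> N"
    using basis by (simp add: V.basis_def cl_def)
  have "W \<subseteq> V.span (cl ` Md)"
  proof
    fix v assume "v \<in> W"
    then obtain f where f: "f \<in> homogeneous n d" "v = coinv_class n f" by (auto simp: W_eq)
    then have fc: "f \<in> carrier (spoly_ring n)" by (simp add: homogeneous_def)
    obtain p where p: "p \<in> carrier (spoly_ring n)" "coinv_class n f = coinv_class n p"
        "coinv_class n (hom_part d p) \<in> V.span (cl ` Md)"
      using carrier_N class_carrier[OF fc] unfolding N_def by blast
    have "coinv_class n f = coinv_class n (hom_part d p)"
      using hom_part_coinv_class[OF fc p(1,2), of d] hom_part_homogeneous[OF f(1), of d] by simp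
    with p(3) f(2) show "v \<in> V.span (cl ` Md)" by simp
  qed
  moreover have "V.span (cl ` Md) \<subseteq> W"
    by (rule V.span_is_subset[OF clMd_W subW])
  moreover have "V.lin_indpt (cl ` Md)"
    using basis V.subset_li_is_li[OF _ clMd] by (simp add: V.basis_def cl_def)
  \<comment> \<open>Span and linear dependence of a subset of \<open>W\<close> are the same in
    \<open>W\<close> as in the whole space.\<close>
  ultimately have basis_W: "W.basis (cl ` Md)"
    using V.span_li_not_depend[OF clMd_W subW] clMd_W unfolding W.basis_def by simp
  have inj_cl: "inj_on cl Md"
    using inj unfolding cl_def by (rule inj_on_subset) (simp add: Md_def)
  have "finite (cl ` Md)"
    using M(1) by (simp add: Md_def)
  then have "W.dim = card (cl ` Md)"
    by (rule W.dim_basis[OF _ basis_W])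
  also have "\<dots> = card Md"
    by (rule card_image[OF inj_cl])
  finally show ?thesis by (simp add: W_def Md_def d_def)
qed

section \<open>Counting the basis\<close>

text \<open>The bounds are integers, like the values of \<open>beta\<close>. If one of them is
  negative, the set is empty, and the corresponding \<open>q_int (B i + 1)\<close> is an empty
  sum.\<close>

definition exponents :: "nat \<Rightarrow> (nat \<Rightarrow> int) \<Rightarrow> (nat \<Rightarrow>\<^sub>0 nat) set" where
  "exponents n B = {b. Poly_Mapping.keys b \<subseteq> {1..n} \<and>
     (\<forall>i \<in> {1..n}. int (Poly_Mapping.lookup b i) \<le> B i)}"

text \<open>Exponent vectors are 0 outside \<open>{1..n}\<close>, elements of \<open>PiE\<close> are
  \<open>undefined\<close> there; \<open>restrict\<close> and the sum of \<open>single\<close> terms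
  translate between the two. The product form is what the distributive law for finite products of
  sums uses.\<close>

lemma bij_betw_exponents:
  "bij_betw (\<lambda>b. restrict (Poly_Mapping.lookup b) {1..n}) (exponents n B)
     (PiE {1..n} (\<lambda>i. {..<nat (B i + 1)}))"
proof (rule bij_betw_byWitness[where f' = "\<lambda>g. \<Sum>i = 1..n. Poly_Mapping.single i (g i)"])
  have lk: "Poly_Mapping.lookup (\<Sum>i = 1..n. Poly_Mapping.single i (g i)) j
      = (if j \<in> {1..n} then g j else 0)" for g :: "nat \<Rightarrow> nat" and j
    by (auto simp: lookup_sum lookup_single when_def sum.delta')
  show "\<forall>b\<in>exponents n B. (\<Sum>i = 1..n. Poly_Mapping.single i
      (restrict (Poly_Mapping.lookup b) {1..n} i)) = b"
    by (intro ballI poly_mapping_eqI, subst lk) (auto simp: exponents_def in_keys_iff)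
  show "\<forall>g\<in>PiE {1..n} (\<lambda>i. {..<nat (B i + 1)}).
      restrict (Poly_Mapping.lookup (\<Sum>i = 1..n. Poly_Mapping.single i (g i))) {1..n} = g"
    by (intro ballI ext) (simp only: lk restrict_def, auto simp: PiE_def extensional_def)
  show "(\<lambda>b. restrict (Poly_Mapping.lookup b) {1..n}) ` exponents n B
      \<subseteq> PiE {1..n} (\<lambda>i. {..<nat (B i + 1)})"
    by (force simp: exponents_def)
  show "(\<lambda>g. \<Sum>i = 1..n. Poly_Mapping.single i (g i)) ` PiE {1..n} (\<lambda>i. {..<nat (B i + 1)})
      \<subseteq> exponents n B"
  proof (rule image_subsetI)
    fix g assume g: "g \<in> PiE {1..n} (\<lambda>i. {..<nat (B i + 1)})"
    have "int (g i) \<le> B i" if "i \<in> {1..n}" for i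
      using PiE_mem[OF g that] by auto
    then show "(\<Sum>i = 1..n. Poly_Mapping.single i (g i)) \<in> exponents n B"
      by (auto simp: exponents_def in_keys_iff lk[simplified] split: if_splits)
  qed
qed

lemma finite_exponents: "finite (exponents n B)"
  using bij_betw_finite[OF bij_betw_exponents[of n B]] by (simp add: finite_PiE)

text \<open>Multiplying out the \<open>q\<close>-integers means choosing a power
  \<open>q_var ^ k\<close> with \<open>k\<close> at most \<open>B i\<close> from each factor, that
  is, an exponent vector; the chosen powers combine to its total degree.\<close>

lemma sum_exponents:
  "(\<Sum>b\<in>exponents n B. q_var ^ (\<Sum>i\<in>Poly_Mapping.keys b. Poly_Mapping.lookup b i))
    = (\<Prod>i = 1..n. q_int (B i + 1))"
proof -
  have "(\<Prod>i = 1..n. q_int (B i + 1))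
      = (\<Sum>g\<in>PiE {1..n} (\<lambda>i. {..<nat (B i + 1)}). \<Prod>i = 1..n. q_var ^ g i)"
    unfolding q_int_def by (rule prod_sum_PiE) auto
  also have "\<dots> = (\<Sum>b\<in>exponents n B. \<Prod>i = 1..n. q_var ^ restrict (Poly_Mapping.lookup b) {1..n} i)"
    by (rule sum.reindex_bij_betw[OF bij_betw_exponents, symmetric])
  also have "\<dots> = (\<Sum>b\<in>exponents n B. q_var ^ (\<Sum>i\<in>Poly_Mapping.keys b. Poly_Mapping.lookup b i))"
  proof (rule sum.cong[OF refl])
    fix b assume b: "b \<in> exponents n B"
    have "(\<Sum>i\<in>Poly_Mapping.keys b. Poly_Mapping.lookup b i) = (\<Sum>i = 1..n. Poly_Mapping.lookup b i)"
      by (rule sum.mono_neutral_left) (use b in \<open>auto simp: exponents_def in_keys_iff\<close>)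
    then show "(\<Prod>i = 1..n. q_var ^ restrict (Poly_Mapping.lookup b) {1..n} i)
        = q_var ^ (\<Sum>i\<in>Poly_Mapping.keys b. Poly_Mapping.lookup b i)"
      by (simp add: power_sum)
  qed
  finally show ?thesis by simp
qed

lemma nth_monomial:
  "fps_nth (fps_nth (fps_nth (u_var ^ j * v_var ^ k * q_var ^ i) a) b) c
    = of_bool ((i, j, k) = (a, b, c))"
proof -
  \<comment> \<open>Sorted by nesting depth: the power of the outermost variable \<open>q\<close> is
    multiplied by a constant series, in which \<open>u\<close> is the variable and \<open>v\<close>
    is again constant. The coefficients can then be read off from the outside in.\<close>
  have "u_var ^ j * v_var ^ k * q_var ^ i = fps_const (fps_X ^ j * fps_const (fps_X ^ k)) * fps_X ^ i"
    by (simp add: u_var_def v_var_def q_var_def fps_const_power fps_const_mult[symmetric]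
        del: fps_const_mult)
  then show ?thesis
    by (simp add: fps_X_power_nth)
qed

lemma finite_Paths_nonneg: "finite (Paths_nonneg n)"
proof -
  have "finite {\<pi> :: step list. set \<pi> \<subseteq> UNIV \<and> length \<pi> = n}"
  proof (rule finite_lists_length_eq)
    have "(UNIV :: step set) = {Up, Level_theta, Level_xi, Down_theta_xi}"
      using step.exhaust by blast
    then show "finite (UNIV :: step set)" by (metis finite.emptyI finite.insertI)
  qed
  then show ?thesis by (rule rev_finite_subset) (auto simp: Paths_nonneg_def)
qed

text \<open>The four kinds of steps correspond to the four ways in which an index can lie in or
  outside the two sets. Hence distinct paths of equal length never contribute the same
  monomial.\<close>

lemma path_eqI:
  assumes "length \<pi> = length \<rho>" "T_set \<pi> = T_set \<rho>" "S_set \<pi> = S_set \<rho>"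
  shows "\<pi> = \<rho>"
proof (rule nth_equalityI[OF assms(1)])
  fix i assume i: "i < length \<pi>"
  \<comment> \<open>List position \<open>i\<close> holds the step with index
    \<open>Suc i\<close>.\<close>
  have "Suc i \<in> T_set \<pi> \<longleftrightarrow> Suc i \<in> T_set \<rho>" "Suc i \<in> S_set \<pi> \<longleftrightarrow> Suc i \<in> S_set \<rho>"
    by (simp_all add: assms)
  then show "\<pi> ! i = \<rho> ! i"
    using i assms(1) by (cases "\<pi> ! i"; cases "\<rho> ! i") (auto simp: T_set_def S_set_def)
qed

theorem proposition9p7:
  fixes n :: nat
  assumes "n \<ge> 1"
    and "inj_on (coinv_class n) (B_set n)"
    and "vectorspace.basis class_ring (coinv_alg n) (coinv_class n ` B_set n)"
  shows "hilbert_series n =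
    (\<Sum>\<pi> \<in> Paths_nonneg n. u_var ^ deg_theta \<pi> * v_var ^ deg_xi \<pi> * stair_B n \<pi>)"
proof -
  \<comment> \<open>The basis monomials are parametrized by pairs of a path and an admissible
    exponent vector, so that counting them becomes a sum over paths.\<close>
  define E where "E = (\<lambda>\<pi>. exponents n (beta (T_set \<pi>) (S_set \<pi>)))"
  define mon where "mon = (\<lambda>(\<pi>, b). (b, T_set \<pi>, S_set \<pi>) :: smonom)"
  define M where "M = mon ` Sigma (Paths_nonneg n) E"
  have fin: "finite (Sigma (Paths_nonneg n) E)"
    by (simp add: E_def finite_Paths_nonneg finite_exponents)
  have inj_mon: "inj_on mon (Sigma (Paths_nonneg n) E)"
    by (auto simp: inj_on_def mon_def Paths_nonneg_def intro: path_eqI)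
  have B_eq: "B_set n = (\<lambda>m. Poly_Mapping.single m 1) ` M"
    by (auto simp: B_set_def M_def mon_def E_def exponents_def image_iff)
  have M_sub: "M \<subseteq> smonoms n"
    by (auto simp: M_def mon_def E_def exponents_def smonoms_def Paths_nonneg_def T_set_def S_set_def)
  \<comment> \<open>A \<open>single\<close> with coefficient 1 has its monomial as its only key, so
    distinct monomials give distinct elements of \<open>B_set n\<close>, to which the assumed
    injectivity applies.\<close>
  have inj_M: "inj_on (\<lambda>m. coinv_class n (Poly_Mapping.single m 1)) M"
  proof (rule comp_inj_on[of _ M "coinv_class n", unfolded comp_def])
    show "inj_on (\<lambda>m. Poly_Mapping.single m (1::complex)) M"
      by (rule inj_onI) (auto dest: arg_cong[where f = Poly_Mapping.keys])
    show "inj_on (coinv_class n) ((\<lambda>m. Poly_Mapping.single m 1) ` M)"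
      using assms(2) by (simp add: B_eq)
  qed
  have stair: "stair_B n \<pi> = (\<Sum>e\<in>E \<pi>. q_var ^ (\<Sum>i\<in>Poly_Mapping.keys e. Poly_Mapping.lookup e i))" for \<pi>
    by (simp only: stair_B_def E_def sum_exponents)
  have "fps_nth (fps_nth (fps_nth (hilbert_series n) a) b) c =
      fps_nth (fps_nth (fps_nth (\<Sum>\<pi> \<in> Paths_nonneg n.
        u_var ^ deg_theta \<pi> * v_var ^ deg_xi \<pi> * stair_B n \<pi>) a) b) c" for a b c
  proof -
    have "fps_nth (fps_nth (fps_nth (hilbert_series n) a) b) c
        = int (card {m \<in> M. tridegree m = (a, b, c)})"
      using dim_coinv_component[OF _ M_sub inj_M, of a b c] fin assms(3)
      by (simp add: hilbert_series_def M_def B_eq[unfolded M_def] image_image)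
    also have "{m \<in> M. tridegree m = (a, b, c)}
        = mon ` {x \<in> Sigma (Paths_nonneg n) E. tridegree (mon x) = (a, b, c)}"
      by (auto simp: M_def)
    also have "int (card \<dots>) = int (card {x \<in> Sigma (Paths_nonneg n) E. tridegree (mon x) = (a, b, c)})"
      by (subst card_image) (auto intro: inj_on_subset[OF inj_mon])
    \<comment> \<open>A sum of indicators matches the coefficients that \<open>nth_monomial\<close>
      yields once each stair product is expanded by \<open>stair\<close>.\<close>
    also have "\<dots> = (\<Sum>x\<in>Sigma (Paths_nonneg n) E. of_bool (tridegree (mon x) = (a, b, c)))"
      using fin by (simp add: of_bool_def sum.If_cases Int_def)
    also have "\<dots> = (\<Sum>\<pi>\<in>Paths_nonneg n. \<Sum>e\<in>E \<pi>. of_bool (tridegree (mon (\<pi>, e)) = (a, b, c)))"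
      by (subst sum.Sigma) (auto simp: E_def finite_Paths_nonneg finite_exponents)
    also have "\<dots> = fps_nth (fps_nth (fps_nth (\<Sum>\<pi> \<in> Paths_nonneg n.
        u_var ^ deg_theta \<pi> * v_var ^ deg_xi \<pi> * stair_B n \<pi>) a) b) c"
      by (simp add: stair sum_distrib_left fps_sum_nth nth_monomial mon_def deg_theta_def deg_xi_def)
    finally show ?thesis .
  qed
  then show ?thesis by (intro fps_ext)
qed

end
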